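(* Let $\Gamma$ be a countable discrete group acting continuously on a compact Hausdorff space $X$, and suppose that the action is amenable. Let $(V;\alpha=(\hat\alpha,c);\beta)$ be a $\Gamma$-$CX$ locally convex module with respect to this action. If a subset $K\subset V$ is $\alpha$-invariant, $CX$-convex, compact and non-empty, then $K$ has an $\alpha$-fixed point, i.e. there is $\tilde c\in K$ with $\alpha_g(\tilde c)=\tilde c$ for all $g\in\Gamma$.
   Context: All vector spaces are over $\mathbb{C}$; locally convex spaces are Hausdorff. $CX$ denotes the $C^*$-algebra of continuous functions $X\to\mathbb{C}$ with the sup norm; $p^g(x):=p(g^{-1}.x)$ for $g\in\Gamma$, $p\in CX$. Amenable action: $\mathrm{Prob}(\Gamma)$ is the set of positive norm-one elements of $\ell^1(\Gamma)$ with the $\ell^1$-norm $\|\cdot\|_1$, with $\Gamma$-action $(g.f)(h)=f(g^{-1}h)$. The action of $\Gamma$ on $X$ is amenable if there is a net $(m_i)_i$ of continuous maps $m_i:X\to\mathrm{Prob}(\Gamma)$ such that for every $g\in\Gamma$, $\sup_{x\in X}\|m_i(g.x)-g.(m_i(x))\|_1\to 0$. Affine actions: an affine action $\alpha$ of $\Gamma$ on a vector space $V$ decomposes uniquely as $\alpha_g(v)=\hat\alpha_g(v)+c_g$ with $\hat\alpha$ a linear action and $c:\Gamma\to V$ satisfying $c_{gh}=c_g+\hat\alpha_g(c_h)$; one writes $\alpha=(\hat\alpha,c)$. $L_\sigma(V)$ is the space of linear maps $V\to V$ with the topology of pointwise convergence on $V$. A $\Gamma$-$CX$ locally convex module is a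 locally convex space $V$ equipped with (i) an affine action $\alpha=(\hat\alpha,c)$ of $\Gamma$ on $V$ such that $\alpha_g:V\to V$ is continuous for each $g\in\Gamma$; and (ii) a continuous linear unital map $\beta:CX\to L_\sigma(V)$ (unital: $\beta(1_X)=\mathrm{id}_V$) satisfying $\hat\alpha_g\circ\beta(p)\circ\hat\alpha_{g^{-1}}=\beta(p^g)$ for all $g\in\Gamma$, $p\in CX$. A subset $K\subset V$ is $CX$-convex if $\sum_{k=1}^n\beta(p_k)(c_k)\in K$ for all $n$, all $c_1,\dots,c_n\in K$ and all $p_1,\dots,p_n\in C(X,[0,1])$ with $\sum_{k=1}^np_k=1_X$. $K$ is $\alpha$-invariant if $\alpha_g(K)\subset K$ for all $g\in\Gamma$. *)

theory Defs
  imports "HOL-Analysis.Analysis" "HOL-Algebra.Group_Action"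
begin

section \<open>Nets\<close>

definition directed_set :: "'i set \<Rightarrow> ('i \<Rightarrow> 'i \<Rightarrow> bool) \<Rightarrow> bool" where
  "directed_set I rel \<longleftrightarrow> I \<noteq> {} \<and> reflp_on I rel \<and> transp_on I rel \<and>
     (\<forall>i\<in>I. \<forall>j\<in>I. \<exists>k\<in>I. rel i k \<and> rel j k)"

definition net_filter :: "'i set \<Rightarrow> ('i \<Rightarrow> 'i \<Rightarrow> bool) \<Rightarrow> 'i filter" where
  "net_filter I rel = (INF i\<in>I. principal {j\<in>I. rel i j})"

lemma eventually_net_filter:
  assumes "directed_set I rel"
  shows "eventually P (net_filter I rel) \<longleftrightarrow> (\<exists>i\<in>I. \<forall>j\<in>I. rel i j \<longrightarrow> P j)"
proof -
  have "eventually P (net_filter I rel) \<longleftrightarrow>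
      (\<exists>i\<in>I. eventually P (principal {j\<in>I. rel i j}))"
    unfolding net_filter_def
  proof (rule eventually_INF_base)
    show "I \<noteq> {}"
      using assms by (simp add: directed_set_def)
    fix a b assume ab: "a \<in> I" "b \<in> I"
    then obtain k where k: "k \<in> I" "rel a k" "rel b k"
      using assms unfolding directed_set_def by blast
    have "transp_on I rel"
      using assms by (simp add: directed_set_def)
    then have "{j\<in>I. rel k j} \<subseteq> {j\<in>I. rel a j} \<inter> {j\<in>I. rel b j}"
      using ab k by (auto dest: transp_onD)
    then show "\<exists>x\<in>I. principal {j\<in>I. rel x j}
        \<le> inf (principal {j\<in>I. rel a j}) (principal {j\<in>I. rel b j})"
      using k(1) by (auto intro!: bexI[of _ k])
  qed
  then show ?thesis
    by (auto simp: eventually_principal)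
qed


section \<open>The spaces \<open>\<ell>\<^sup>1(\<Gamma>)\<close> and \<open>Prob(\<Gamma>)\<close>\<close>

text \<open>Functions on the carrier are represented by their extensional extensions, so that
  equality in \<open>ell1 G\<close> is equality of functions on the carrier.\<close>

definition ell1 :: "('g, 'm) monoid_scheme \<Rightarrow> ('g \<Rightarrow> complex) set" where
  "ell1 G = {f \<in> extensional (carrier G). (\<lambda>h. norm (f h)) summable_on carrier G}"

definition ell1_norm :: "('g, 'm) monoid_scheme \<Rightarrow> ('g \<Rightarrow> complex) \<Rightarrow> real" where
  "ell1_norm G f = (\<Sum>\<^sub>\<infinity>h\<in>carrier G. norm (f h))"

definition ell1_metric :: "('g, 'm) monoid_scheme \<Rightarrow> ('g \<Rightarrow> complex) metric" where
  "ell1_metric G = metric (ell1 G, \<lambda>f f'. ell1_norm G (\<lambda>h. f h - f' h))"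

lemma ell1_diff_summable:
  assumes "f \<in> ell1 G" "f' \<in> ell1 G"
  shows "(\<lambda>h. norm (f h - f' h)) summable_on carrier G"
proof (rule Infinite_Sum.abs_summable_on_comparison_test')
  show "(\<lambda>h. norm (f h) + norm (f' h)) summable_on carrier G"
    using assms by (intro summable_on_add) (auto simp: ell1_def)
qed (rule norm_triangle_ineq4)

lemma Metric_space_ell1: "Metric_space (ell1 G) (\<lambda>f f'. ell1_norm G (\<lambda>h. f h - f' h))"
proof
  fix f f' :: "'a \<Rightarrow> complex"
  show "0 \<le> ell1_norm G (\<lambda>h. f h - f' h)"
    by (simp add: ell1_norm_def infsum_nonneg)
  show "ell1_norm G (\<lambda>h. f h - f' h) = ell1_norm G (\<lambda>h. f' h - f h)"
    by (simp add: ell1_norm_def norm_minus_commute)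
next
  fix f f' assume f: "f \<in> ell1 G" "f' \<in> ell1 G"
  note s = ell1_diff_summable[OF f]
  show "ell1_norm G (\<lambda>h. f h - f' h) = 0 \<longleftrightarrow> f = f'"
  proof
    assume *: "ell1_norm G (\<lambda>h. f h - f' h) = 0"
    have "f h = f' h" if "h \<in> carrier G" for h
      using nonneg_infsum_le_0D[of "\<lambda>h. norm (f h - f' h)" "carrier G" h] s that *
      by (simp add: ell1_norm_def)
    then show "f = f'"
      using f by (intro extensionalityI[of _ "carrier G"]) (auto simp: ell1_def)
  qed (simp add: ell1_norm_def)
next
  fix f f' f'' assume f: "f \<in> ell1 G" "f' \<in> ell1 G" "f'' \<in> ell1 G"
  have "ell1_norm G (\<lambda>h. f h - f'' h)
      \<le> (\<Sum>\<^sub>\<infinity>h\<in>carrier G. norm (f h - f' h) + norm (f' h - f'' h))"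
    unfolding ell1_norm_def
  proof (rule infsum_mono)
    show "(\<lambda>h. norm (f h - f' h) + norm (f' h - f'' h)) summable_on carrier G"
      using f by (intro summable_on_add ell1_diff_summable)
    show "norm (f h - f'' h) \<le> norm (f h - f' h) + norm (f' h - f'' h)" for h
      using norm_triangle_ineq[of "f h - f' h" "f' h - f'' h"] by simp
  qed (rule ell1_diff_summable[OF f(1,3)])
  also have "\<dots> = ell1_norm G (\<lambda>h. f h - f' h) + ell1_norm G (\<lambda>h. f' h - f'' h)"
    unfolding ell1_norm_def using f by (intro infsum_add ell1_diff_summable)
  finally show "ell1_norm G (\<lambda>h. f h - f'' h)
      \<le> ell1_norm G (\<lambda>h. f h - f' h) + ell1_norm G (\<lambda>h. f' h - f'' h)" .
qed

lemma mspace_ell1_metric [simp]: "mspace (ell1_metric G) = ell1 G"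
  by (simp add: ell1_metric_def Metric_space.mspace_metric[OF Metric_space_ell1])

lemma mdist_ell1_metric [simp]:
  "mdist (ell1_metric G) = (\<lambda>f f'. ell1_norm G (\<lambda>h. f h - f' h))"
  by (simp add: ell1_metric_def Metric_space.mdist_metric[OF Metric_space_ell1])

definition Prob :: "('g, 'm) monoid_scheme \<Rightarrow> ('g \<Rightarrow> complex) set" where
  "Prob G = {f \<in> ell1 G. (\<forall>h\<in>carrier G. f h \<in> \<real>\<^sub>\<ge>\<^sub>0) \<and> ell1_norm G f = 1}"

definition translate :: "('g, 'm) monoid_scheme \<Rightarrow> 'g \<Rightarrow> ('g \<Rightarrow> complex) \<Rightarrow> 'g \<Rightarrow> complex" where
  "translate G g f = (\<lambda>h\<in>carrier G. f (inv\<^bsub>G\<^esub> g \<otimes>\<^bsub>G\<^esub> h))"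


section \<open>Continuous and amenable actions\<close>

locale continuous_action = group_action G "topspace X" \<phi>
  for G :: "('g, 'm) monoid_scheme" (structure) and X :: "'x topology" and \<phi> :: "'g \<Rightarrow> 'x \<Rightarrow> 'x" +
  assumes continuous: "g \<in> carrier G \<Longrightarrow> continuous_map X X (\<phi> g)"

text \<open>The type argument is the type from which the index set of the net is taken. The supremum
  is formed in \<^typ>\<open>ennreal\<close>, where the supremum of the empty set is 0.\<close>

definition amenable_action ::
  "'i itself \<Rightarrow> ('g, 'm) monoid_scheme \<Rightarrow> 'x topology \<Rightarrow> ('g \<Rightarrow> 'x \<Rightarrow> 'x) \<Rightarrow> bool" where
  "amenable_action (_ :: 'i itself) G X \<phi> \<longleftrightarrow>
     (\<exists>(I :: 'i set) rel (m :: 'i \<Rightarrow> 'x \<Rightarrow> 'g \<Rightarrow> complex).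
        directed_set I rel \<and>
        (\<forall>i\<in>I. continuous_map X (subtopology (mtopology_of (ell1_metric G)) (Prob G)) (m i)) \<and>
        (\<forall>g\<in>carrier G.
           ((\<lambda>i. SUP x\<in>topspace X.
               ennreal (ell1_norm G (\<lambda>h. m i (\<phi> g x) h - translate G g (m i x) h)))
             \<longlongrightarrow> 0) (net_filter I rel)))"


section \<open>Locally convex spaces and affine actions\<close>

text \<open>The complex scalar multiplication extends the real one of the type class
  \<^class>\<open>real_vector\<close>, which makes \<^const>\<open>convex\<close> available. Continuity of addition and the
  Hausdorff property come from the type classes.\<close>

locale complex_lcs = vector_space smul
  for smul :: "complex \<Rightarrow> 'v::{real_vector, topological_ab_group_add, t2_space} \<Rightarrow> 'v" +
  assumes scale_of_real: "smul (complex_of_real r) v = r *\<^sub>R v"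
    and continuous_scale: "continuous_on UNIV (\<lambda>(z, v). smul z v)"
    and locally_convex:
      "\<lbrakk>open (U :: 'v set); 0 \<in> U\<rbrakk> \<Longrightarrow> \<exists>C. open C \<and> convex C \<and> 0 \<in> C \<and> C \<subseteq> U"

locale affine_action = vector_space smul + action: group_action G UNIV \<alpha>
  for smul :: "complex \<Rightarrow> 'v::ab_group_add \<Rightarrow> 'v"
    and G :: "('g, 'm) monoid_scheme" (structure)
    and \<alpha> :: "'g \<Rightarrow> 'v \<Rightarrow> 'v"
    and \<alpha>_lin :: "'g \<Rightarrow> 'v \<Rightarrow> 'v"
    and c :: "'g \<Rightarrow> 'v" +
  assumes linear_part_action: "group_action G UNIV \<alpha>_lin"
    and linear_part_linear: "g \<in> carrier G \<Longrightarrow> Vector_Spaces.linear smul smul (\<alpha>_lin g)"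
    and cocycle: "\<lbrakk>g \<in> carrier G; h \<in> carrier G\<rbrakk> \<Longrightarrow> c (g \<otimes> h) = c g + \<alpha>_lin g (c h)"
    and decomposition: "g \<in> carrier G \<Longrightarrow> \<alpha> g v = \<alpha>_lin g v + c g"


section \<open>\<open>\<Gamma>\<close>-\<open>CX\<close> locally convex modules\<close>

text \<open>For compact \<open>X\<close>, \<open>cfunspace\<close> consists of all (extensional) continuous functions
  on \<open>X\<close>, with the sup metric.\<close>

abbreviation CX :: "'x topology \<Rightarrow> ('x \<Rightarrow> complex) metric" where
  "CX X \<equiv> cfunspace X euclidean_metric"

text \<open>The factors of the product are indexed by the points of \<open>V\<close>, so the product topology is
  the topology of pointwise convergence.\<close>

definition L_sigma ::
  "(complex \<Rightarrow> 'v::{ab_group_add, topological_space} \<Rightarrow> 'v) \<Rightarrow> ('v \<Rightarrow> 'v) topology" where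
  "L_sigma smul = subtopology (product_topology (\<lambda>_. euclidean) UNIV)
     {T. Vector_Spaces.linear smul smul T}"

locale Gamma_CX_lc_module =
    complex_lcs smul + affine_action smul G \<alpha> \<alpha>_lin c
  for G :: "('g, 'm) monoid_scheme" (structure)
    and X :: "'x topology"
    and \<phi> :: "'g \<Rightarrow> 'x \<Rightarrow> 'x"
    and smul :: "complex \<Rightarrow> 'v::{real_vector, topological_ab_group_add, t2_space} \<Rightarrow> 'v"
    and \<alpha> :: "'g \<Rightarrow> 'v \<Rightarrow> 'v"
    and \<alpha>_lin :: "'g \<Rightarrow> 'v \<Rightarrow> 'v"
    and c :: "'g \<Rightarrow> 'v"
    and \<beta> :: "('x \<Rightarrow> complex) \<Rightarrow> 'v \<Rightarrow> 'v" +
  assumes affine_continuous: "g \<in> carrier G \<Longrightarrow> continuous_on UNIV (\<alpha> g)"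
    and \<beta>_continuous: "continuous_map (mtopology_of (CX X)) (L_sigma smul) \<beta>"
    and \<beta>_add: "\<lbrakk>p \<in> mspace (CX X); q \<in> mspace (CX X)\<rbrakk>
      \<Longrightarrow> \<beta> (\<lambda>x\<in>topspace X. p x + q x) v = \<beta> p v + \<beta> q v"
    and \<beta>_scale: "p \<in> mspace (CX X)
      \<Longrightarrow> \<beta> (\<lambda>x\<in>topspace X. z * p x) v = smul z (\<beta> p v)"
    and \<beta>_unital: "\<beta> (\<lambda>x\<in>topspace X. 1) = id"
    and \<beta>_equivariant: "\<lbrakk>g \<in> carrier G; p \<in> mspace (CX X)\<rbrakk>
      \<Longrightarrow> \<alpha>_lin g \<circ> \<beta> p \<circ> \<alpha>_lin (inv g) = \<beta> (\<lambda>x\<in>topspace X. p (\<phi> (inv g) x))"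

definition CX_convex ::
  "'x topology \<Rightarrow> (('x \<Rightarrow> complex) \<Rightarrow> 'v::ab_group_add \<Rightarrow> 'v) \<Rightarrow> 'v set \<Rightarrow> bool" where
  "CX_convex X \<beta> K \<longleftrightarrow>
     (\<forall>(n::nat) (v :: nat \<Rightarrow> 'v) (p :: nat \<Rightarrow> 'x \<Rightarrow> complex).
        (\<forall>k\<in>{1..n}. v k \<in> K) \<and>
        (\<forall>k\<in>{1..n}. p k \<in> mspace (CX X) \<and> p k ` topspace X \<subseteq> complex_of_real ` {0..1}) \<and>
        (\<forall>x\<in>topspace X. (\<Sum>k=1..n. p k x) = 1)
        \<longrightarrow> (\<Sum>k=1..n. \<beta> (p k) (v k)) \<in> K)"

definition action_invariant ::
  "('g, 'm) monoid_scheme \<Rightarrow> ('g \<Rightarrow> 'v \<Rightarrow> 'v) \<Rightarrow> 'v set \<Rightarrow> bool" where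
  "action_invariant G \<alpha> K \<longleftrightarrow> (\<forall>g\<in>carrier G. \<alpha> g ` K \<subseteq> K)"

end

theory Submission
  imports Defs
begin

text \<open>
  Averaging the orbit of a point \<open>v0 \<in> K\<close> with the functions provided by amenability gives
  points of \<open>K\<close> that are almost fixed, and compactness turns these into a fixed point.

  Amenability yields, for a finite set \<open>E\<close> of group elements and \<open>e > 0\<close>, a finite continuous
  partition of unity \<open>(p h)\<close> on \<open>X\<close>, indexed by the group, that moves by at most \<open>e\<close> in the
  pointwise \<open>\<ell>\<^sup>1\<close>-distance when an element of \<open>E\<close> acts on \<open>X\<close> and on the index at the same time
  (\<open>amenable_action_partitions_of_unity\<close>). The average \<open>k = (\<Sum>h. \<beta> (p h) (\<alpha> h v0))\<close> lies in \<open>K\<close>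
  because \<open>K\<close> is \<open>CX\<close>-convex and invariant. Equivariance of \<open>\<beta>\<close> shows that \<open>\<alpha> g k\<close> is the average
  of the same vectors with the moved partition of unity
  (\<open>affine_action_real_mult_sum\<close>); the cocycle is absorbed because the weights sum to one.

  It remains to see that close partitions of unity give close averages, for vectors ranging over
  all of \<open>K\<close>. This is where \<open>CX\<close>-convexity is used a second time
  (\<open>CX_convex_combination_diff\<close>): if the \<open>\<ell>\<^sup>1\<close>-distance is at most \<open>e\<close>, then the difference of the
  averages is \<open>e\<close> times a difference of two points of \<open>K\<close>. Hence \<open>\<alpha> g k - k \<in> e (K - K)\<close>
  for all \<open>g \<in> E\<close>. For fixed \<open>g\<close> and \<open>e\<close> this condition defines a closed set, so the finite
  intersection property gives one \<open>k \<in> K\<close> that satisfies it for all \<open>g\<close> and all \<open>e > 0\<close>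
  (\<open>common_fixed_point_if_approximate\<close>). As \<open>K - K\<close> is compact, it is bounded, so that the sets
  \<open>e (K - K)\<close> have only \<open>0\<close> in common, and \<open>\<alpha> g k = k\<close>.
\<close>

section \<open>Approximate fixed points in a compact set\<close>

text \<open>Compact sets are bounded. Here this is seen on scalars: the scalars \<open>e \<in> [0, 1]\<close> with \<open>w \<in> e D\<close> form a projection of a compact set, hence
  a closed set, which contains \<open>0\<close> as soon as it contains all positive \<open>e\<close>.\<close>

lemma all_multiples_in_compact_imp_zero:
  fixes D :: "'v::{real_vector, topological_ab_group_add, t2_space} set"
  assumes scale: "continuous_on UNIV (\<lambda>(r::real, v::'v). r *\<^sub>R v)"
    and D: "compact D"
    and w: "\<And>e. e > 0 \<Longrightarrow> \<exists>u\<in>D. w = e *\<^sub>R u"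
  shows "w = 0"
proof -
  let ?s = "\<lambda>(r::real, v::'v). r *\<^sub>R v"
  have "closed (?s -` {w})"
    by (intro closed_vimage closed_singleton scale)
  then have "compact (({0..1} \<times> D) \<inter> (?s -` {w}))"
    by (intro compact_Int_closed compact_Times D compact_Icc)
  then have "compact (fst ` (({0..1} \<times> D) \<inter> (?s -` {w})))"
    by (intro compact_continuous_image continuous_intros)
  then have cl: "closed (fst ` (({0..1} \<times> D) \<inter> (?s -` {w})))"
    by (rule compact_imp_closed)
  have mem: "e \<in> fst ` (({0..1} \<times> D) \<inter> (?s -` {w}))" if e: "0 < e" "e \<le> 1" for e
  proof -
    obtain u where "u \<in> D" "w = e *\<^sub>R u" using w[OF e(1)] by blast
    then show ?thesis using e by (intro image_eqI[of _ _ "(e, u)"]) auto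
  qed
  have "0 \<in> fst ` (({0..1} \<times> D) \<inter> (?s -` {w}))"
  proof (rule closed_sequentially[OF cl])
    show "inverse (real (Suc n)) \<in> fst ` (({0..1} \<times> D) \<inter> (?s -` {w}))" for n
      by (rule mem) (simp_all add: field_simps)
    show "(\<lambda>n. inverse (real (Suc n))) \<longlonglongrightarrow> 0"
      by (rule LIMSEQ_inverse_real_of_nat)
  qed
  then show "w = 0" by auto
qed

text \<open>The error is measured by multiples of the compact set \<open>K - K\<close>. The approximation hypothesis
  is asked for every scale \<open>d \<ge> e\<close>, so that finitely many conditions at different scales follow
  from the one at the smallest scale.\<close>

lemma common_fixed_point_if_approximate:
  fixes K :: "'v::{real_vector, topological_ab_group_add, t2_space} set"
    and T :: "'i \<Rightarrow> 'v \<Rightarrow> 'v"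
  assumes scale: "continuous_on UNIV (\<lambda>(r::real, v::'v). r *\<^sub>R v)"
    and K: "compact K"
    and T: "\<And>i. i \<in> I \<Longrightarrow> continuous_on UNIV (T i)"
    and approx: "\<And>E e. \<lbrakk>finite E; E \<subseteq> I; e > 0\<rbrakk>
      \<Longrightarrow> \<exists>k\<in>K. \<forall>i\<in>E. \<forall>d\<ge>e. \<exists>u\<in>K. \<exists>w\<in>K. T i k - k = d *\<^sub>R (u - w)"
  shows "\<exists>k\<in>K. \<forall>i\<in>I. T i k = k"
proof -
  define D where "D = (\<lambda>(u, w). u - w) ` (K \<times> K)"
  have D: "compact D"
    unfolding D_def split_def
    by (intro compact_continuous_image compact_Times K continuous_intros)
  have in_D: "u - w \<in> D" if "u \<in> K" "w \<in> K" for u w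
    using that by (auto simp: D_def)
  define B where "B = (\<lambda>(i, e). {k. T i k - k \<in> (\<lambda>v. e *\<^sub>R v) ` D})"
  have "K \<inter> \<Inter> (B ` (I \<times> {0<..})) \<noteq> {}"
  proof (rule compact_imp_fip[OF K])
    fix S assume "S \<in> B ` (I \<times> {0<..})"
    then obtain i and e :: real where i: "i \<in> I" and S: "S = B (i, e)" by auto
    have "continuous_on D (\<lambda>v. e *\<^sub>R v)"
    proof -
      have "continuous_on D ((\<lambda>(r::real, v::'v). r *\<^sub>R v) \<circ> (\<lambda>v. (e, v)))"
        by (rule continuous_on_compose) (auto intro!: continuous_intros continuous_on_subset[OF scale])
      then show ?thesis by (simp add: o_def)
    qed
    then have "closed ((\<lambda>v. e *\<^sub>R v) ` D)"
      by (intro compact_imp_closed compact_continuous_image D)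
    moreover have "continuous_on UNIV (\<lambda>k. T i k - k)"
      by (intro continuous_intros T i)
    ultimately have "closed ((\<lambda>k. T i k - k) -` ((\<lambda>v. e *\<^sub>R v) ` D))"
      by (rule closed_vimage)
    then show "closed S"
      by (simp add: S B_def vimage_def)
  next
    fix F' assume "finite F'" "F' \<subseteq> B ` (I \<times> {0<..})"
    then obtain J where J: "finite J" "J \<subseteq> I \<times> {0<..}" "F' = B ` J"
      by (meson finite_subset_image)
    define e where "e = Min (insert 1 (snd ` J))"
    have "\<forall>d\<in>insert 1 (snd ` J). d > 0"
      using J(2) by auto
    then have "e > 0"
      using J(1) by (simp add: e_def)
    moreover have "fst ` J \<subseteq> I" "finite (fst ` J)"
      using J by auto
    ultimately obtain k where k: "k \<in> K"
        "\<forall>i\<in>fst ` J. \<forall>d\<ge>e. \<exists>u\<in>K. \<exists>w\<in>K. T i k - k = d *\<^sub>R (u - w)"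
      using approx by meson
    have e: "e \<le> d" if "(i, d) \<in> J" for i d
      unfolding e_def using J(1) that by (intro Min_le) force+
    have "k \<in> B j" if jJ: "j \<in> J" for j
    proof -
      obtain i d where j: "j = (i, d)" by fastforce
      obtain u w where "u \<in> K" "w \<in> K" "T i k - k = d *\<^sub>R (u - w)"
      proof -
        have "i \<in> fst ` J" using jJ j by force
        then show thesis using k(2) e[of i d] jJ that j by blast
      qed
      then show ?thesis
        using in_D by (auto simp: B_def j)
    qed
    then show "K \<inter> \<Inter> F' \<noteq> {}"
      using k(1) J by blast
  qed
  then obtain k where k: "k \<in> K" "\<And>i e. i \<in> I \<Longrightarrow> e > 0 \<Longrightarrow> k \<in> B (i, e)"
    by fast
  have "T i k = k" if "i \<in> I" for i
  proof -
    have "T i k - k = 0"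
    proof (rule all_multiples_in_compact_imp_zero[OF scale D])
      show "\<exists>u\<in>D. T i k - k = e *\<^sub>R u" if "e > 0" for e
        using k(2)[OF \<open>i \<in> I\<close> that] by (auto simp: B_def)
    qed
    then show ?thesis by simp
  qed
  then show ?thesis using k(1) by blast
qed

section \<open>Real continuous functions acting on the module\<close>

text \<open>The partitions of unity of the proof are real valued, and positive parts of differences
  of their members are taken. It is therefore convenient to let real functions act, and to let the
  values of these functions outside \<open>X\<close> be arbitrary.\<close>

lemma of_real_continuous_in_CX:
  assumes "compact_space X" "continuous_map X euclideanreal f"
  shows "(\<lambda>x\<in>topspace X. complex_of_real (f x)) \<in> mspace (CX X)"
proof -
  have c: "continuous_map X euclidean (\<lambda>x. complex_of_real (f x))"
    using continuous_map_compose[OF assms(2), of euclidean complex_of_real]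
    by (simp add: o_def continuous_on_of_real)
  then have c': "continuous_map X euclidean (\<lambda>x\<in>topspace X. complex_of_real (f x))"
    by (rule continuous_map_eq) auto
  have "compactin euclidean ((\<lambda>x\<in>topspace X. complex_of_real (f x)) ` topspace X)"
    using assms(1) c' by (intro image_compactin) (auto simp: compact_space_def)
  then have "bounded ((\<lambda>x\<in>topspace X. complex_of_real (f x)) ` topspace X)"
    by (simp add: compact_imp_bounded)
  with c' show ?thesis
    by simp
qed

locale compact_Gamma_CX_lc_module = Gamma_CX_lc_module G X \<phi> smul \<alpha> \<alpha>_lin c \<beta>
  for G :: "('g, 'm) monoid_scheme" (structure)
    and X :: "'x topology"
    and \<phi> :: "'g \<Rightarrow> 'x \<Rightarrow> 'x"
    and smul :: "complex \<Rightarrow> 'v::{real_vector, topological_ab_group_add, t2_space} \<Rightarrow> 'v"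
    and \<alpha> :: "'g \<Rightarrow> 'v \<Rightarrow> 'v"
    and \<alpha>_lin :: "'g \<Rightarrow> 'v \<Rightarrow> 'v"
    and c :: "'g \<Rightarrow> 'v"
    and \<beta> :: "('x \<Rightarrow> complex) \<Rightarrow> 'v \<Rightarrow> 'v" +
  assumes compact: "compact_space X"
begin

lemma continuous_scaleR: "continuous_on UNIV (\<lambda>(r::real, v::'v). r *\<^sub>R v)"
proof -
  have "continuous_on UNIV ((\<lambda>(z, v). smul z v) \<circ> (\<lambda>p. (complex_of_real (fst p), snd p)))"
    by (rule continuous_on_compose)
      (auto intro!: continuous_intros continuous_on_subset[OF continuous_scale])
  then show ?thesis
    by (simp add: o_def split_def scale_of_real)
qed

definition real_mult :: "('x \<Rightarrow> real) \<Rightarrow> 'v \<Rightarrow> 'v" where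
  "real_mult f = \<beta> (\<lambda>x\<in>topspace X. complex_of_real (f x))"

lemma real_mult_cong:
  "(\<And>x. x \<in> topspace X \<Longrightarrow> f x = f' x) \<Longrightarrow> real_mult f = real_mult f'"
  by (simp add: real_mult_def cong: restrict_cong)

lemma real_mult_add:
  assumes "continuous_map X euclideanreal f" "continuous_map X euclideanreal f'"
  shows "real_mult (\<lambda>x. f x + f' x) v = real_mult f v + real_mult f' v"
proof -
  have "(\<lambda>x\<in>topspace X. complex_of_real (f x + f' x))
      = (\<lambda>x\<in>topspace X. (\<lambda>x\<in>topspace X. complex_of_real (f x)) x
          + (\<lambda>x\<in>topspace X. complex_of_real (f' x)) x)"
    by auto
  then show ?thesis
    unfolding real_mult_def
    using \<beta>_add[OF of_real_continuous_in_CX[OF compact assms(1)]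
        of_real_continuous_in_CX[OF compact assms(2)], of v] by simp
qed

lemma real_mult_scale:
  assumes "continuous_map X euclideanreal f"
  shows "real_mult (\<lambda>x. r * f x) v = r *\<^sub>R real_mult f v"
proof -
  have "(\<lambda>x\<in>topspace X. complex_of_real (r * f x))
      = (\<lambda>x\<in>topspace X. complex_of_real r * (\<lambda>x\<in>topspace X. complex_of_real (f x)) x)"
    by auto
  then show ?thesis
    unfolding real_mult_def
    using \<beta>_scale[OF of_real_continuous_in_CX[OF compact assms],
        of "complex_of_real r" v] by (simp add: scale_of_real)
qed

lemma real_mult_zero: "real_mult (\<lambda>x. 0) v = 0"
  using real_mult_scale[of "\<lambda>x. 0" 0 v] by simp

lemma real_mult_eq_zero:
  "(\<And>x. x \<in> topspace X \<Longrightarrow> f x = 0) \<Longrightarrow> real_mult f v = 0"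
  using real_mult_cong[of f "\<lambda>x. 0"] real_mult_zero by simp

lemma real_mult_one: "real_mult (\<lambda>x. 1) v = v"
  by (simp add: real_mult_def \<beta>_unital)

lemma real_mult_sum:
  assumes "finite A" "\<And>a. a \<in> A \<Longrightarrow> continuous_map X euclideanreal (f a)"
  shows "real_mult (\<lambda>x. \<Sum>a\<in>A. f a x) v = (\<Sum>a\<in>A. real_mult (f a) v)"
  using assms
  by (induction A) (simp_all add: real_mult_zero real_mult_add continuous_map_sum)

lemma real_mult_vec_add:
  assumes "continuous_map X euclideanreal f"
  shows "real_mult f (v + w) = real_mult f v + real_mult f w"
proof -
  have "\<beta> (\<lambda>x\<in>topspace X. complex_of_real (f x)) \<in> topspace (L_sigma smul)"
    using \<beta>_continuous of_real_continuous_in_CX[OF compact assms]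
    by (metis continuous_map_image_subset_topspace image_subset_iff topspace_mtopology_of)
  then have "Vector_Spaces.linear smul smul (real_mult f)"
    by (simp add: L_sigma_def real_mult_def)
  then interpret Vector_Spaces.linear smul smul "real_mult f" .
  show ?thesis by (rule add)
qed

lemma linear_part_real_mult:
  assumes g: "g \<in> carrier G" and f: "continuous_map X euclideanreal f"
    and \<phi>: "\<phi> (inv g) ` topspace X \<subseteq> topspace X"
  shows "\<alpha>_lin g (real_mult f v) = real_mult (\<lambda>x. f (\<phi> (inv g) x)) (\<alpha>_lin g v)"
proof -
  interpret lin: group_action G UNIV \<alpha>_lin by (rule linear_part_action)
  have "\<alpha>_lin (inv g) (\<alpha>_lin g v) = v"
    using g by (intro lin.orbit_sym_aux) auto
  then have "\<alpha>_lin g (real_mult f v)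
      = (\<alpha>_lin g \<circ> real_mult f \<circ> \<alpha>_lin (inv g)) (\<alpha>_lin g v)"
    by simp
  also have "\<dots> = \<beta> (\<lambda>x\<in>topspace X. (\<lambda>x\<in>topspace X. complex_of_real (f x)) (\<phi> (inv g) x))
      (\<alpha>_lin g v)"
    unfolding real_mult_def
    by (subst \<beta>_equivariant[OF g of_real_continuous_in_CX[OF compact f]]) simp
  also have "(\<lambda>x\<in>topspace X. (\<lambda>x\<in>topspace X. complex_of_real (f x)) (\<phi> (inv g) x))
      = (\<lambda>x\<in>topspace X. complex_of_real (f (\<phi> (inv g) x)))"
    using \<phi> by (intro restrict_ext) auto
  finally show ?thesis unfolding real_mult_def .
qed

text \<open>The linear part moves the weights by equivariance. The translation part \<open>c g\<close> can be
  written as its own average with respect to the moved weights, which sum to one, and then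
  combines with the linear parts termwise.\<close>

lemma affine_action_real_mult_sum:
  assumes g: "g \<in> carrier G" and A: "finite A"
    and p: "\<And>a. a \<in> A \<Longrightarrow> continuous_map X euclideanreal (p a)"
    and p1: "\<And>x. x \<in> topspace X \<Longrightarrow> (\<Sum>a\<in>A. p a x) = 1"
    and \<phi>: "continuous_map X X (\<phi> (inv g))"
  shows "\<alpha> g (\<Sum>a\<in>A. real_mult (p a) (w a))
    = (\<Sum>a\<in>A. real_mult (\<lambda>x. p a (\<phi> (inv g) x)) (\<alpha> g (w a)))"
proof -
  interpret lin: Vector_Spaces.linear smul smul "\<alpha>_lin g" by (rule linear_part_linear[OF g])
  have \<phi>': "\<phi> (inv g) ` topspace X \<subseteq> topspace X"
    using \<phi> by (simp add: continuous_map_image_subset_topspace)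
  have pc: "continuous_map X euclideanreal (\<lambda>x. p a (\<phi> (inv g) x))" if "a \<in> A" for a
    using continuous_map_compose[OF \<phi> p[OF that]] by (simp add: o_def)
  have "real_mult (\<lambda>x. \<Sum>a\<in>A. p a (\<phi> (inv g) x)) = real_mult (\<lambda>x. 1)"
    using \<phi>' p1 by (intro real_mult_cong) blast
  then have c1: "(\<Sum>a\<in>A. real_mult (\<lambda>x. p a (\<phi> (inv g) x)) (c g)) = c g"
    using real_mult_sum[OF A pc, of "\<lambda>a. a" "c g"] by (simp add: real_mult_one)
  have "\<alpha> g (\<Sum>a\<in>A. real_mult (p a) (w a)) = (\<Sum>a\<in>A. \<alpha>_lin g (real_mult (p a) (w a))) + c g"
    by (simp add: decomposition[OF g] lin.sum)
  also have "\<dots> = (\<Sum>a\<in>A. real_mult (\<lambda>x. p a (\<phi> (inv g) x)) (\<alpha>_lin g (w a)))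
      + (\<Sum>a\<in>A. real_mult (\<lambda>x. p a (\<phi> (inv g) x)) (c g))"
    using c1 linear_part_real_mult[OF g p \<phi>'] by simp
  also have "\<dots> = (\<Sum>a\<in>A. real_mult (\<lambda>x. p a (\<phi> (inv g) x)) (\<alpha> g (w a)))"
    by (simp add: sum.distrib[symmetric] real_mult_vec_add[OF pc] decomposition[OF g])
  finally show ?thesis .
qed

lemma CX_convex_sum_mem:
  assumes K: "CX_convex X \<beta> K" and A: "finite A"
    and w: "\<And>a. a \<in> A \<Longrightarrow> w a \<in> K"
    and p: "\<And>a. a \<in> A \<Longrightarrow> continuous_map X euclideanreal (p a)"
    and p0: "\<And>a x. \<lbrakk>a \<in> A; x \<in> topspace X\<rbrakk> \<Longrightarrow> 0 \<le> p a x"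
    and p1: "\<And>x. x \<in> topspace X \<Longrightarrow> (\<Sum>a\<in>A. p a x) = 1"
  shows "(\<Sum>a\<in>A. real_mult (p a) (w a)) \<in> K"
proof -
  obtain b where b: "bij_betw b {1..card A} A"
    using ex_bij_betw_nat_finite_1[OF A] by blast
  let ?P = "\<lambda>k. \<lambda>x\<in>topspace X. complex_of_real (p (b k) x)"
  have bA: "b k \<in> A" if "k \<in> {1..card A}" for k
    using b that by (auto simp: bij_betw_def)
  have "(\<Sum>k=1..card A. \<beta> (?P k) (w (b k))) \<in> K"
  proof (rule K[unfolded CX_convex_def, rule_format], intro conjI ballI)
    fix k assume k: "k \<in> {1..card A}"
    show "w (b k) \<in> K" by (intro w bA k)
    show "?P k \<in> mspace (CX X)"
      by (intro of_real_continuous_in_CX compact p bA k)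
    have "p (b k) x \<le> 1" if "x \<in> topspace X" for x
      using member_le_sum[of "b k" A "\<lambda>a. p a x"] p0 p1 bA[OF k] A that by auto
    then show "?P k ` topspace X \<subseteq> complex_of_real ` {0..1}"
      using p0[OF bA[OF k]] by auto
  next
    fix x assume x: "x \<in> topspace X"
    have "(\<Sum>k=1..card A. p (b k) x) = 1"
      using p1[OF x] sum.reindex_bij_betw[OF b, of "\<lambda>a. p a x"] by simp
    then show "(\<Sum>k=1..card A. ?P k x) = 1"
      using x by (simp flip: of_real_sum)
  qed
  also have "(\<Sum>k=1..card A. \<beta> (?P k) (w (b k))) = (\<Sum>a\<in>A. real_mult (p a) (w a))"
    using sum.reindex_bij_betw[OF b, of "\<lambda>a. real_mult (p a) (w a)"] by (simp add: real_mult_def)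
  finally show ?thesis .
qed

text \<open>This is the estimate that replaces equicontinuity of the operators \<open>\<beta> p\<close>. With
  \<open>d = (q - p) / e\<close>, the positive parts of \<open>d\<close> have the same sum \<open>t \<le> 1\<close> as its negative parts.
  Both families become partitions of unity when \<open>(1 - t) p\<close> is added to them, and the difference of
  the two is still \<open>d\<close>.\<close>

lemma CX_convex_combination_diff:
  assumes K: "CX_convex X \<beta> K" and A: "finite A"
    and w: "\<And>a. a \<in> A \<Longrightarrow> w a \<in> K"
    and p: "\<And>a. a \<in> A \<Longrightarrow> continuous_map X euclideanreal (p a)"
    and p0: "\<And>a x. \<lbrakk>a \<in> A; x \<in> topspace X\<rbrakk> \<Longrightarrow> 0 \<le> p a x"
    and p1: "\<And>x. x \<in> topspace X \<Longrightarrow> (\<Sum>a\<in>A. p a x) = 1"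
    and q: "\<And>a. a \<in> A \<Longrightarrow> continuous_map X euclideanreal (q a)"
    and q1: "\<And>x. x \<in> topspace X \<Longrightarrow> (\<Sum>a\<in>A. q a x) = 1"
    and e: "e > 0"
    and close: "\<And>x. x \<in> topspace X \<Longrightarrow> (\<Sum>a\<in>A. \<bar>q a x - p a x\<bar>) \<le> e"
  shows "\<exists>u\<in>K. \<exists>v\<in>K. (\<Sum>a\<in>A. real_mult (q a) (w a)) - (\<Sum>a\<in>A. real_mult (p a) (w a))
    = e *\<^sub>R (u - v)"
proof -
  \<comment> \<open>The products and the factor \<open>- 1\<close> are there to match the rules for continuity and linearity.\<close>
  define d where "d a x = (1 / e) * (q a x + (-1) * p a x)" for a x
  define t where "t x = (\<Sum>a\<in>A. max (d a x) 0)" for x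
  define U where "U a x = max (d a x) 0 + (1 - t x) * p a x" for a x
  define V where "V a x = max (- d a x) 0 + (1 - t x) * p a x" for a x
  have dc: "continuous_map X euclideanreal (d a)" if "a \<in> A" for a
    unfolding d_def using that by (intro continuous_intros p q) auto
  have tc: "continuous_map X euclideanreal t"
    unfolding t_def by (intro continuous_intros A dc) auto
  have Uc: "continuous_map X euclideanreal (U a)" if "a \<in> A" for a
    unfolding U_def using that by (intro continuous_intros p dc tc) auto
  have Vc: "continuous_map X euclideanreal (V a)" if "a \<in> A" for a
    unfolding V_def using that by (intro continuous_intros p dc tc) auto
  have t1: "t x \<le> 1" if "x \<in> topspace X" for x
  proof -
    have "t x \<le> (\<Sum>a\<in>A. (1 / e) * \<bar>q a x - p a x\<bar>)"
      unfolding t_def d_def using e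
      by (intro sum_mono) (auto simp: max_def divide_simps)
    also have "\<dots> \<le> 1"
      using close[OF that] e unfolding sum_distrib_left[symmetric] by (simp add: field_simps)
    finally show ?thesis .
  qed
  have d0: "(\<Sum>a\<in>A. d a x) = 0" if "x \<in> topspace X" for x
    using p1[OF that] q1[OF that]
    by (simp add: d_def sum_distrib_left[symmetric] sum_subtractf sum_divide_distrib[symmetric])
  have UV: "U a x = V a x + d a x" for a x
    by (auto simp: U_def V_def max_def)
  have U1: "(\<Sum>a\<in>A. U a x) = 1" if "x \<in> topspace X" for x
    using p1[OF that] by (simp add: U_def sum.distrib sum_distrib_left[symmetric] t_def[symmetric])
  have V1: "(\<Sum>a\<in>A. V a x) = 1" if "x \<in> topspace X" for x
    using U1[OF that] d0[OF that] by (simp add: UV sum.distrib)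
  have "(\<Sum>a\<in>A. real_mult (U a) (w a)) \<in> K"
    using Uc U1 t1 p0 by (intro CX_convex_sum_mem[OF K A w]) (auto simp: U_def)
  moreover have "(\<Sum>a\<in>A. real_mult (V a) (w a)) \<in> K"
    using Vc V1 t1 p0 by (intro CX_convex_sum_mem[OF K A w]) (auto simp: V_def)
  moreover have "(\<Sum>a\<in>A. real_mult (q a) (w a)) - (\<Sum>a\<in>A. real_mult (p a) (w a))
    = e *\<^sub>R ((\<Sum>a\<in>A. real_mult (U a) (w a)) - (\<Sum>a\<in>A. real_mult (V a) (w a)))"
  proof -
    have "real_mult (q a) (w a) - real_mult (p a) (w a)
        = e *\<^sub>R (real_mult (U a) (w a) - real_mult (V a) (w a))" if a: "a \<in> A" for a
    proof -
      have "q a x = p a x + e * d a x" for x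
        using e by (simp add: d_def)
      then have "real_mult (q a) (w a) = real_mult (\<lambda>x. p a x + e * d a x) (w a)"
        by metis
      also have "\<dots> = real_mult (p a) (w a) + e *\<^sub>R real_mult (d a) (w a)"
        using p dc a by (simp add: real_mult_add real_mult_scale continuous_map_real_mult)
      finally have 1: "real_mult (q a) (w a) - real_mult (p a) (w a) = e *\<^sub>R real_mult (d a) (w a)"
        by simp
      have "real_mult (U a) (w a) = real_mult (V a) (w a) + real_mult (d a) (w a)"
        using real_mult_add[OF Vc dc, OF a a] UV[of a] by (metis real_mult_cong)
      with 1 show ?thesis by simp
    qed
    then show ?thesis
      by (simp add: sum_subtractf[symmetric] scaleR_sum_right)
  qed
  ultimately show ?thesis by blast
qed

end


section \<open>Finitely supported almost equivariant partitions of unity\<close>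

text \<open>A continuous map from \<open>X\<close> into \<open>Prob(\<Gamma>)\<close> is a family of nonnegative functions on \<open>X\<close>,
  indexed by the group, with infinite sum one. The next lemmas split it into its members and cut
  it off to a finite family.\<close>

lemma continuous_map_ell1_coordinate:
  assumes h: "h \<in> carrier G"
  shows "continuous_map (mtopology_of (ell1_metric G)) euclideanreal (\<lambda>f. Re (f h))"
proof -
  have "Lipschitz_continuous_map (ell1_metric G) euclidean_metric (\<lambda>f. Re (f h))"
    unfolding Lipschitz_continuous_map_def
  proof (intro conjI exI ballI)
    fix f f' assume f: "f \<in> mspace (ell1_metric G)" "f' \<in> mspace (ell1_metric G)"
    have "dist (Re (f h)) (Re (f' h)) \<le> norm (f h - f' h)"
      using abs_Re_le_cmod[of "f h - f' h"] by (simp add: dist_real_def)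
    also have "\<dots> \<le> ell1_norm G (\<lambda>h. f h - f' h)"
      using finite_sum_le_infsum[of "\<lambda>h. norm (f h - f' h)" "carrier G" "{h}"] h f
      by (simp add: ell1_norm_def ell1_diff_summable)
    finally show "mdist euclidean_metric (Re (f h)) (Re (f' h)) \<le> 1 * mdist (ell1_metric G) f f'"
      by simp
  qed auto
  then show ?thesis
    using Lipschitz_continuous_imp_continuous_map by fastforce
qed

lemma Prob_Re:
  assumes "f \<in> Prob G" "h \<in> carrier G"
  shows "norm (f h) = Re (f h)" "0 \<le> Re (f h)"
  using assms by (auto simp: Prob_def complex_nonneg_Reals_iff cmod_eq_Re)

lemma Prob_finite_sum_le_1:
  assumes f: "f \<in> Prob G" and H: "finite H" "H \<subseteq> carrier G"
  shows "(\<Sum>h\<in>H. Re (f h)) \<le> 1"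
proof -
  have "(\<Sum>h\<in>H. Re (f h)) = (\<Sum>h\<in>H. norm (f h))"
    using Prob_Re[OF f] H(2) by (intro sum.cong) auto
  also have "\<dots> \<le> ell1_norm G f"
    unfolding ell1_norm_def using f H by (intro finite_sum_le_infsum) (auto simp: Prob_def ell1_def)
  also have "\<dots> = 1" using f by (simp add: Prob_def)
  finally show ?thesis .
qed

text \<open>Each single \<open>m x\<close> has almost all of its mass on a finite set, which also serves all points
  near \<open>x\<close>; by compactness, a finite union of such sets serves all of \<open>X\<close>.\<close>

lemma Prob_uniformly_tight:
  assumes X: "compact_space X"
    and m: "continuous_map X (subtopology (mtopology_of (ell1_metric G)) (Prob G)) m"
    and e: "e > 0"
  shows "\<exists>F. finite F \<and> F \<subseteq> carrier G \<and> (\<forall>x\<in>topspace X. 1 - e < (\<Sum>h\<in>F. Re (m x h)))"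
proof -
  have mP: "m x \<in> Prob G" if "x \<in> topspace X" for x
    using m that by (auto simp: continuous_map_in_subtopology)
  define U where "U F = {x \<in> topspace X. (\<Sum>h\<in>F. Re (m x h)) \<in> {1 - e<..}}" for F
  define \<F> where "\<F> = {F. finite F \<and> F \<subseteq> carrier G}"
  have "openin X (U F)" if F: "F \<in> \<F>" for F
  proof -
    have "continuous_map X euclideanreal (\<lambda>x. Re (m x h))" if "h \<in> F" for h
      using continuous_map_compose[OF continuous_map_into_fulltopology[OF m]
          continuous_map_ell1_coordinate[of h G]] F that
      by (auto simp: o_def \<F>_def)
    then have "continuous_map X euclideanreal (\<lambda>x. \<Sum>h\<in>F. Re (m x h))"
      using F by (intro continuous_map_sum) (auto simp: \<F>_def)
    then show ?thesis
      unfolding U_def by (rule openin_continuous_map_preimage) simp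
  qed
  moreover have "topspace X \<subseteq> \<Union> (U ` \<F>)"
  proof
    fix x assume x: "x \<in> topspace X"
    have "(\<lambda>h. norm (m x h)) summable_on carrier G" and 1: "(\<Sum>\<^sub>\<infinity>h\<in>carrier G. norm (m x h)) = 1"
      using mP[OF x] by (auto simp: Prob_def ell1_def ell1_norm_def)
    then obtain F where F: "finite F" "F \<subseteq> carrier G" "dist (\<Sum>h\<in>F. norm (m x h)) 1 \<le> e / 2"
      using infsum_finite_approximation[of "\<lambda>h. norm (m x h)" "carrier G" "e / 2"] e by auto
    have eq: "(\<Sum>h\<in>F. norm (m x h)) = (\<Sum>h\<in>F. Re (m x h))"
      using Prob_Re[OF mP[OF x]] F by (intro sum.cong) auto
    have "x \<in> U F"
      using F(3)[unfolded dist_real_def eq, THEN abs_le_D2] x e by (simp add: U_def)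
    then show "x \<in> \<Union> (U ` \<F>)"
      using F by (auto simp: \<F>_def)
  qed
  ultimately obtain \<S> where S: "finite \<S>" "\<S> \<subseteq> \<F>" "topspace X \<subseteq> \<Union> (U ` \<S>)"
    using X unfolding compact_space_alt
    by (smt (verit, best) finite_subset_image imageE)
  have fin: "finite (\<Union> \<S>)" "\<Union> \<S> \<subseteq> carrier G"
    using S by (auto simp: \<F>_def)
  have "1 - e < (\<Sum>h\<in>\<Union> \<S>. Re (m x h))" if x: "x \<in> topspace X" for x
  proof -
    obtain F where F: "F \<in> \<S>" "x \<in> U F" using S(3) x by auto
    have "(\<Sum>h\<in>F. Re (m x h)) \<le> (\<Sum>h\<in>\<Union> \<S>. Re (m x h))"
      using fin F Prob_Re(2)[OF mP[OF x]] by (intro sum_mono2) auto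
    then show ?thesis using F by (simp add: U_def)
  qed
  then show ?thesis using fin by blast
qed

lemma translate_in_ell1:
  assumes "group G" and g: "g \<in> carrier G" and f: "f \<in> ell1 G"
  shows "translate G g f \<in> ell1 G"
proof -
  interpret group G by fact
  have b: "bij_betw (\<lambda>h. inv\<^bsub>G\<^esub> g \<otimes>\<^bsub>G\<^esub> h) (carrier G) (carrier G)"
    using g by (intro bij_betwI[of _ _ _ "\<lambda>h. g \<otimes>\<^bsub>G\<^esub> h"]) (auto simp: m_assoc[symmetric])
  have "(\<lambda>h. norm (f (inv\<^bsub>G\<^esub> g \<otimes>\<^bsub>G\<^esub> h))) summable_on carrier G"
    using summable_on_reindex_bij_betw[OF b, of "\<lambda>h. norm (f h)"] f by (simp add: ell1_def)
  then have "(\<lambda>h. norm (translate G g f h)) summable_on carrier G"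
    by (rule summable_on_cong[THEN iffD1, rotated]) (simp add: translate_def)
  then show ?thesis
    by (simp add: ell1_def translate_def)
qed

text \<open>For finitely many group elements and one tolerance, a single member of the net suffices.\<close>

lemma amenable_action_Reiter:
  fixes G :: "('g, 'm) monoid_scheme" and X :: "'x topology" and \<phi> :: "'g \<Rightarrow> 'x \<Rightarrow> 'x"
  assumes "amenable_action TYPE('i) G X \<phi>" and E: "finite E" "E \<subseteq> carrier G" and e: "e > 0"
  shows "\<exists>m. continuous_map X (subtopology (mtopology_of (ell1_metric G)) (Prob G)) m \<and>
    (\<forall>g\<in>E. \<forall>x\<in>topspace X. ell1_norm G (\<lambda>h. m (\<phi> g x) h - translate G g (m x) h) < e)"
proof -
  obtain I :: "'i set" and rel and m :: "'i \<Rightarrow> 'x \<Rightarrow> 'g \<Rightarrow> complex" where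
    I: "directed_set I rel" and
    m: "\<And>i. i \<in> I \<Longrightarrow> continuous_map X (subtopology (mtopology_of (ell1_metric G)) (Prob G)) (m i)" and
    lim: "\<And>g. g \<in> carrier G \<Longrightarrow> ((\<lambda>i. SUP x\<in>topspace X.
         ennreal (ell1_norm G (\<lambda>h. m i (\<phi> g x) h - translate G g (m i x) h)))
             \<longlongrightarrow> 0) (net_filter I rel)"
    using assms(1) unfolding amenable_action_def by blast
  have "\<forall>\<^sub>F i in net_filter I rel. \<forall>g\<in>E. (SUP x\<in>topspace X.
      ennreal (ell1_norm G (\<lambda>h. m i (\<phi> g x) h - translate G g (m i x) h))) < ennreal e"
    using E e by (intro eventually_ball_finite ballI order_tendstoD(2)[OF lim]) auto
  then obtain i where i: "i \<in> I" and *: "\<And>j. \<lbrakk>j \<in> I; rel i j\<rbrakk> \<Longrightarrow> \<forall>g\<in>E. (SUP x\<in>topspace X.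
      ennreal (ell1_norm G (\<lambda>h. m j (\<phi> g x) h - translate G g (m j x) h))) < ennreal e"
    unfolding eventually_net_filter[OF I] by blast
  have "rel i i"
    using I i by (simp add: directed_set_def reflp_on_def)
  note ** = *[OF i this]
  have "ell1_norm G (\<lambda>h. m i (\<phi> g x) h - translate G g (m i x) h) < e"
    if "g \<in> E" "x \<in> topspace X" for g x
  proof -
    have "ennreal (ell1_norm G (\<lambda>h. m i (\<phi> g x) h - translate G g (m i x) h)) < ennreal e"
      using ** that by (meson SUP_upper le_less_trans)
    then show ?thesis
      using e by (simp add: ennreal_less_iff ell1_norm_def infsum_nonneg)
  qed
  then show ?thesis using m[OF i] by blast
qed

text \<open>The map provided by amenability is cut off to a finite set \<open>F\<close> that carries all of the mass
  of each \<open>m x\<close> up to \<open>d\<close>; the lost mass \<open>r\<close> is put on the unit element. This changes each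
  \<open>m x\<close> by at most \<open>2 d\<close> in \<open>\<ell>\<^sup>1\<close>-norm. Comparing the truncated values at \<open>x\<close> and at \<open>g\<inverse> x\<close> thus
  costs \<open>2 d\<close> for each of them, and \<open>d\<close> for the almost equivariance of \<open>m\<close>.\<close>

lemma amenable_action_partitions_of_unity:
  fixes G :: "('g, 'm) monoid_scheme" and X :: "'x topology" and \<phi> :: "'g \<Rightarrow> 'x \<Rightarrow> 'x"
  assumes G: "group G" and X: "compact_space X" and act: "continuous_action G X \<phi>"
    and amen: "amenable_action TYPE('i) G X \<phi>"
    and E: "finite E" "E \<subseteq> carrier G" and e: "e > 0"
  obtains F and p :: "'g \<Rightarrow> 'x \<Rightarrow> real"
  where "finite F" "F \<subseteq> carrier G"
    and "\<And>h. h \<in> carrier G \<Longrightarrow> continuous_map X euclideanreal (p h)"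
    and "\<And>h x. \<lbrakk>h \<in> carrier G; x \<in> topspace X\<rbrakk> \<Longrightarrow> 0 \<le> p h x"
    and "\<And>h x. h \<notin> F \<Longrightarrow> p h x = 0"
    and "\<And>x. x \<in> topspace X \<Longrightarrow> (\<Sum>h\<in>F. p h x) = 1"
    and "\<And>g x H. \<lbrakk>g \<in> E; x \<in> topspace X; finite H; H \<subseteq> carrier G\<rbrakk>
      \<Longrightarrow> (\<Sum>h\<in>H. \<bar>p (inv\<^bsub>G\<^esub> g \<otimes>\<^bsub>G\<^esub> h) (\<phi> (inv\<^bsub>G\<^esub> g) x) - p h x\<bar>) \<le> e"
proof -
  interpret group G by fact
  interpret continuous_action G X \<phi> by fact
  define d where "d = e / 5"
  have d: "d > 0" using e by (simp add: d_def)
  obtain m where m: "continuous_map X (subtopology (mtopology_of (ell1_metric G)) (Prob G)) m"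
    and inv: "\<And>g x. \<lbrakk>g \<in> E; x \<in> topspace X\<rbrakk>
      \<Longrightarrow> ell1_norm G (\<lambda>h. m (\<phi> g x) h - translate G g (m x) h) < d"
    using amenable_action_Reiter[OF amen E d] by blast
  define \<mu> where "\<mu> h x = Re (m x h)" for h x
  have mP: "m x \<in> Prob G" if "x \<in> topspace X" for x
    using m that by (auto simp: continuous_map_in_subtopology)
  have \<mu>0: "0 \<le> \<mu> h x" if "h \<in> carrier G" "x \<in> topspace X" for h x
    using Prob_Re(2)[OF mP] that by (simp add: \<mu>_def)
  have \<mu>c: "continuous_map X euclideanreal (\<mu> h)" if "h \<in> carrier G" for h
    using continuous_map_compose[OF continuous_map_into_fulltopology[OF m]
        continuous_map_ell1_coordinate[OF that]]
    by (simp add: o_def \<mu>_def[abs_def])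
  obtain F0 where F0: "finite F0" "F0 \<subseteq> carrier G"
    and tight: "\<And>x. x \<in> topspace X \<Longrightarrow> 1 - d < (\<Sum>h\<in>F0. \<mu> h x)"
    using Prob_uniformly_tight[OF X m d] unfolding \<mu>_def by blast
  \<comment> \<open>The unit element has to belong to the support, as it receives the lost mass.\<close>
  define F where "F = insert \<one>\<^bsub>G\<^esub> F0"
  have F: "finite F" "F \<subseteq> carrier G" "\<one>\<^bsub>G\<^esub> \<in> F"
    using F0 by (auto simp: F_def)
  define r where "r x = 1 - (\<Sum>h\<in>F. \<mu> h x)" for x
  have r0: "0 \<le> r x" if "x \<in> topspace X" for x
    using Prob_finite_sum_le_1[OF mP[OF that] F(1,2)] by (simp add: r_def \<mu>_def)
  have rd: "r x \<le> d" if "x \<in> topspace X" for x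
  proof -
    have "(\<Sum>h\<in>F0. \<mu> h x) \<le> (\<Sum>h\<in>F. \<mu> h x)"
      using F \<mu>0 that by (intro sum_mono2) (auto simp: F_def)
    then show ?thesis using tight[OF that] by (simp add: r_def)
  qed
  define p where "p h x = (if h \<in> F then \<mu> h x + (if h = \<one>\<^bsub>G\<^esub> then r x else 0) else 0)" for h x
  have rc: "continuous_map X euclideanreal r"
    unfolding r_def using F by (intro continuous_intros \<mu>c) auto
  have pc: "continuous_map X euclideanreal (p h)" if "h \<in> carrier G" for h
  proof -
    have "continuous_map X euclideanreal (\<lambda>x. \<mu> h x + r x)"
      by (intro continuous_intros \<mu>c that rc)
    then show ?thesis
      using \<mu>c[OF that] by (cases "h \<in> F"; cases "h = \<one>\<^bsub>G\<^esub>") (simp_all add: p_def[abs_def])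
  qed
  have p0: "0 \<le> p h x" if "h \<in> carrier G" "x \<in> topspace X" for h x
    using \<mu>0[OF that] r0[OF that(2)] by (simp add: p_def)
  have p1: "(\<Sum>h\<in>F. p h x) = 1" for x
  proof -
    have "(\<Sum>h\<in>F. p h x) = (\<Sum>h\<in>F. \<mu> h x + (if h = \<one>\<^bsub>G\<^esub> then r x else 0))"
      by (intro sum.cong) (simp_all add: p_def)
    also have "\<dots> = 1"
      using F by (simp add: sum.distrib r_def)
    finally show ?thesis .
  qed
  have p\<mu>: "(\<Sum>h\<in>H. \<bar>p h x - \<mu> h x\<bar>) \<le> 2 * d"
    if x: "x \<in> topspace X" and H: "finite H" "H \<subseteq> carrier G" for x H
  proof -
    have "(\<Sum>h\<in>H. \<bar>p h x - \<mu> h x\<bar>)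
        \<le> (\<Sum>h\<in>H. (if h \<in> F then 0 else \<mu> h x) + (if h = \<one>\<^bsub>G\<^esub> then r x else 0))"
      using r0[OF x] \<mu>0[OF _ x] H(2) by (intro sum_mono) (auto simp: p_def)
    also have "\<dots> = (\<Sum>h\<in>H - F. \<mu> h x) + (if \<one>\<^bsub>G\<^esub> \<in> H then r x else 0)"
      using H(1) by (simp add: sum.distrib sum.If_cases Diff_eq)
    also have "(\<Sum>h\<in>H - F. \<mu> h x) = (\<Sum>h\<in>H \<union> F. \<mu> h x) - (\<Sum>h\<in>F. \<mu> h x)"
      using F H by (subst sum_diff[symmetric]) (auto intro: sum.cong)
    also have "\<dots> \<le> r x"
      using Prob_finite_sum_le_1[OF mP[OF x], of "H \<union> F"] F H by (simp add: r_def \<mu>_def)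
    finally show ?thesis
      using r0[OF x] rd[OF x] by (simp split: if_splits)
  qed
  have "(\<Sum>h\<in>H. \<bar>p (inv\<^bsub>G\<^esub> g \<otimes>\<^bsub>G\<^esub> h) (\<phi> (inv\<^bsub>G\<^esub> g) x) - p h x\<bar>) \<le> e"
    if g: "g \<in> E" and x: "x \<in> topspace X" and H: "finite H" "H \<subseteq> carrier G" for g x H
  proof -
    have gG: "g \<in> carrier G" using g E by auto
    define y where "y = \<phi> (inv\<^bsub>G\<^esub> g) x"
    have y: "y \<in> topspace X"
      using element_image[OF inv_closed[OF gG] x] by (simp add: y_def)
    have yx: "\<phi> g y = x"
      using orbit_sym_aux[of "inv\<^bsub>G\<^esub> g" x y] gG x by (simp add: y_def)
    let ?k = "\<lambda>h. inv\<^bsub>G\<^esub> g \<otimes>\<^bsub>G\<^esub> h"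
    have inj: "inj_on ?k H"
      using inj_on_cmult[of "inv\<^bsub>G\<^esub> g"] gG H(2) by (auto intro: inj_on_subset)
    have kH: "finite (?k ` H)" "?k ` H \<subseteq> carrier G"
      using gG H by auto
    have "(\<Sum>h\<in>H. \<bar>p (?k h) y - \<mu> (?k h) y\<bar>) \<le> 2 * d"
      using p\<mu>[OF y kH] by (simp add: sum.reindex[OF inj])
    moreover have "(\<Sum>h\<in>H. \<bar>\<mu> (?k h) y - \<mu> h x\<bar>) \<le> d"
    proof -
      have "(\<Sum>h\<in>H. \<bar>\<mu> (?k h) y - \<mu> h x\<bar>) \<le> (\<Sum>h\<in>H. norm (m x h - translate G g (m y) h))"
      proof (rule sum_mono)
        fix h assume "h \<in> H"
        then have "translate G g (m y) h = m y (?k h)"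
          using H by (auto simp: translate_def)
        then show "\<bar>\<mu> (?k h) y - \<mu> h x\<bar> \<le> norm (m x h - translate G g (m y) h)"
          using abs_Re_le_cmod[of "m x h - m y (?k h)"] by (simp add: \<mu>_def)
      qed
      also have "\<dots> \<le> ell1_norm G (\<lambda>h. m x h - translate G g (m y) h)"
        unfolding ell1_norm_def using mP[OF x] mP[OF y]
        by (intro finite_sum_le_infsum ell1_diff_summable translate_in_ell1 G gG H)
          (auto simp: Prob_def)
      also have "\<dots> < d"
        using inv[OF g y] by (simp add: yx)
      finally show ?thesis by simp
    qed
    moreover have "(\<Sum>h\<in>H. \<bar>p h x - \<mu> h x\<bar>) \<le> 2 * d"
      by (rule p\<mu>[OF x H])
    moreover have "(\<Sum>h\<in>H. \<bar>p (?k h) y - p h x\<bar>)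
        \<le> (\<Sum>h\<in>H. \<bar>p (?k h) y - \<mu> (?k h) y\<bar> + \<bar>\<mu> (?k h) y - \<mu> h x\<bar> + \<bar>p h x - \<mu> h x\<bar>)"
      by (intro sum_mono) arith
    ultimately show ?thesis
      by (simp add: sum.distrib y_def[symmetric] d_def)
  qed
  then show ?thesis
    using that[OF F(1,2) pc p0 _ p1] by (simp add: p_def)
qed

section \<open>The fixed point theorem\<close>

text \<open>The almost fixed point is the average of the orbit of a point of \<open>K\<close>. Acting with \<open>g\<close>
  turns the \<open>h\<close>-th orbit point into the \<open>g h\<close>-th one, so that after the substitution
  \<open>h \<mapsto> g\<inverse> h\<close> both averages are taken over the same vectors and differ only in the weights.\<close>

lemma (in compact_Gamma_CX_lc_module) approximate_fixed_point:
  assumes G: "group G" and act: "continuous_action G X \<phi>"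
    and amen: "amenable_action TYPE('i) G X \<phi>"
    and inv: "action_invariant G \<alpha> K" and conv: "CX_convex X \<beta> K" and ne: "K \<noteq> {}"
    and E: "finite E" "E \<subseteq> carrier G" and e: "e > 0"
  shows "\<exists>k\<in>K. \<forall>g\<in>E. \<forall>d\<ge>e. \<exists>u\<in>K. \<exists>w\<in>K. \<alpha> g k - k = d *\<^sub>R (u - w)"
proof -
  interpret group G by fact
  interpret X: continuous_action G X \<phi> by fact
  obtain v0 where v0: "v0 \<in> K" using ne by blast
  obtain F p where F: "finite F" "F \<subseteq> carrier G"
    and pc: "\<And>h. h \<in> carrier G \<Longrightarrow> continuous_map X euclideanreal (p h)"
    and p0: "\<And>h x. \<lbrakk>h \<in> carrier G; x \<in> topspace X\<rbrakk> \<Longrightarrow> 0 \<le> p h x"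
    and pF: "\<And>h x. h \<notin> F \<Longrightarrow> p h x = 0"
    and p1: "\<And>x. x \<in> topspace X \<Longrightarrow> (\<Sum>h\<in>F. p h x) = 1"
    and close: "\<And>g x H. \<lbrakk>g \<in> E; x \<in> topspace X; finite H; H \<subseteq> carrier G\<rbrakk>
      \<Longrightarrow> (\<Sum>h\<in>H. \<bar>p (inv g \<otimes> h) (\<phi> (inv g) x) - p h x\<bar>) \<le> e"
    by (rule amenable_action_partitions_of_unity[OF G compact act amen E e]) (rule that)
  define w where "w h = \<alpha> h v0" for h
  have w: "w h \<in> K" if "h \<in> carrier G" for h
    using inv v0 that by (auto simp: w_def action_invariant_def)
  define k where "k = (\<Sum>h\<in>F. real_mult (p h) (w h))"
  have "k \<in> K"
    unfolding k_def using F by (intro CX_convex_sum_mem[OF conv] w pc p0 p1) auto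
  moreover have "\<exists>u\<in>K. \<exists>v\<in>K. \<alpha> g k - k = d *\<^sub>R (u - v)" if g: "g \<in> E" and d: "d \<ge> e" for g d
  proof -
    have gG: "g \<in> carrier G" using g E by auto
    have \<phi>: "continuous_map X X (\<phi> (inv g))"
      using gG by (intro X.continuous) auto
    define q where "q h x = p (inv g \<otimes> h) (\<phi> (inv g) x)" for h x
    \<comment> \<open>The weights of \<open>k\<close> live on \<open>F\<close> and those of \<open>\<alpha> g k\<close> on the translate \<open>g F\<close>; both sums are
      extended by zero to a common index set.\<close>
    define H where "H = F \<union> (\<lambda>h. g \<otimes> h) ` F"
    have H: "finite H" "H \<subseteq> carrier G" "F \<subseteq> H" "(\<lambda>h. g \<otimes> h) ` F \<subseteq> H"
      using F gG by (auto simp: H_def)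
    have inj: "inj_on (\<lambda>h. g \<otimes> h) F"
      using inj_on_cmult[OF gG] F(2) by (rule inj_on_subset)
    have cancel: "inv g \<otimes> (g \<otimes> h) = h" "g \<otimes> (inv g \<otimes> h) = h" if "h \<in> carrier G" for h
      using gG that by (simp_all add: m_assoc[symmetric])
    have qF: "q h x = 0" if "h \<in> H - (\<lambda>h. g \<otimes> h) ` F" for h x
    proof -
      have "inv g \<otimes> h \<notin> F"
        using that H(2) cancel(2)[of h] by (metis DiffD1 DiffD2 image_eqI subsetD)
      then show ?thesis by (simp add: q_def pF)
    qed
    have qg: "q (g \<otimes> h) = (\<lambda>x. p h (\<phi> (inv g) x))" if "h \<in> F" for h
      using cancel(1)[of h] that F(2) by (intro ext) (auto simp: q_def)
    have "k = (\<Sum>h\<in>H. real_mult (p h) (w h))"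
      unfolding k_def using H pF
      by (intro sum.mono_neutral_left) (auto intro!: real_mult_eq_zero)
    moreover have "\<alpha> g k = (\<Sum>h\<in>H. real_mult (q h) (w h))"
    proof -
      have "\<alpha> g k = (\<Sum>h\<in>F. real_mult (\<lambda>x. p h (\<phi> (inv g) x)) (\<alpha> g (w h)))"
        unfolding k_def
        using F by (intro affine_action_real_mult_sum[OF gG _ _ _ \<phi>] pc p1) auto
      also have "\<dots> = (\<Sum>h\<in>F. real_mult (q (g \<otimes> h)) (w (g \<otimes> h)))"
        using F gG qg by (intro sum.cong) (auto simp: w_def action.composition_rule)
      also have "\<dots> = (\<Sum>h\<in>(\<lambda>h. g \<otimes> h) ` F. real_mult (q h) (w h))"
        by (simp add: sum.reindex[OF inj])
      also have "\<dots> = (\<Sum>h\<in>H. real_mult (q h) (w h))"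
        using H qF by (intro sum.mono_neutral_left) (auto intro!: real_mult_eq_zero)
      finally show ?thesis .
    qed
    moreover have "\<exists>u\<in>K. \<exists>v\<in>K. (\<Sum>h\<in>H. real_mult (q h) (w h)) - (\<Sum>h\<in>H. real_mult (p h) (w h))
      = d *\<^sub>R (u - v)"
    proof (rule CX_convex_combination_diff[OF conv H(1)])
      fix h assume "h \<in> H"
      then have h: "h \<in> carrier G" using H by auto
      show "w h \<in> K" "continuous_map X euclideanreal (p h)"
        using h by (auto intro: w pc)
      show "continuous_map X euclideanreal (q h)"
        using continuous_map_compose[OF \<phi> pc[of "inv g \<otimes> h"]] gG h
        by (simp add: o_def q_def[abs_def])
      show "0 \<le> p h x" if "x \<in> topspace X" for x by (rule p0[OF h that])
    next
      fix x assume x: "x \<in> topspace X"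
      show "(\<Sum>h\<in>H. p h x) = 1"
        using p1[OF x] sum.mono_neutral_left[OF H(1,3), of "\<lambda>h. p h x"] pF by auto
      have "(\<Sum>h\<in>H. q h x) = (\<Sum>h\<in>(\<lambda>h. g \<otimes> h) ` F. q h x)"
        using H qF by (intro sum.mono_neutral_right) auto
      also have "\<dots> = (\<Sum>h\<in>F. p h (\<phi> (inv g) x))"
        using qg by (simp add: sum.reindex[OF inj])
      also have "\<dots> = 1"
        using \<phi> x by (intro p1) (auto simp: continuous_map_def)
      finally show "(\<Sum>h\<in>H. q h x) = 1" .
      show "(\<Sum>h\<in>H. \<bar>q h x - p h x\<bar>) \<le> d"
        using close[OF g x H(1,2)] d by (simp add: q_def)
    qed (use e d in auto)
    ultimately show ?thesis by simp
  qed
  ultimately show ?thesis by blast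
qed

theorem theorem4p4:
  fixes G :: "('g, 'm) monoid_scheme"
    and X :: "'x topology"
    and \<phi> :: "'g \<Rightarrow> 'x \<Rightarrow> 'x"
    and smul :: "complex \<Rightarrow> 'v::{real_vector, topological_ab_group_add, t2_space} \<Rightarrow> 'v"
    and \<alpha> \<alpha>_lin :: "'g \<Rightarrow> 'v \<Rightarrow> 'v"
    and c :: "'g \<Rightarrow> 'v"
    and \<beta> :: "('x \<Rightarrow> complex) \<Rightarrow> 'v \<Rightarrow> 'v"
    and K :: "'v set"
  assumes "group G" and "countable (carrier G)"
    and "compact_space X" and "Hausdorff_space X"
    and "continuous_action G X \<phi>"
    and "amenable_action TYPE('i) G X \<phi>"
    and "Gamma_CX_lc_module G X \<phi> smul \<alpha> \<alpha>_lin c \<beta>"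
    and "action_invariant G \<alpha> K" and "CX_convex X \<beta> K" and "compact K" and "K \<noteq> {}"
  shows "\<exists>v\<in>K. \<forall>g\<in>carrier G. \<alpha> g v = v"
proof -
  interpret Gamma_CX_lc_module G X \<phi> smul \<alpha> \<alpha>_lin c \<beta> by fact
  interpret compact_Gamma_CX_lc_module G X \<phi> smul \<alpha> \<alpha>_lin c \<beta>
    by unfold_locales fact
  show ?thesis
  proof (rule common_fixed_point_if_approximate[OF continuous_scaleR \<open>compact K\<close>])
    show "\<exists>k\<in>K. \<forall>g\<in>E. \<forall>d\<ge>e. \<exists>u\<in>K. \<exists>w\<in>K. \<alpha> g k - k = d *\<^sub>R (u - w)"
      if "finite E" "E \<subseteq> carrier G" "e > 0" for E and e :: real
      by (rule approximate_fixed_point) (fact assms that)+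
  qed (rule affine_continuous)
qed

end
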